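(* Let $\Gamma$ be a finite index subgroup of $\mathrm{SL}(2,\mathbb{Z})$. Denote $e_1 = \begin{pmatrix}1\\0\end{pmatrix}$ and $T=\begin{pmatrix}1&1\\0&1\end{pmatrix}$. Suppose that for each prime $p$ there exist matrices $A_1, A_2 \in \mathrm{SL}(2,\mathbb{Z})$ with the following properties: (A) For all $j \in \mathbb{N}$: $A_1e_1 \not\equiv j\cdot A_2e_1 \pmod p$. (B) There exist $m_1,m_2 \in \mathbb{N}$ such that $A_1T^{m_1}A_1^{-1}$ and $A_2T^{m_2}A_2^{-1}$ are contained in $\Gamma$, and $p$ divides neither $m_1$ nor $m_2$. Then $\Gamma$ is a totally non congruence group.
   Context: A finite index subgroup $\Gamma$ of $\mathrm{SL}(2,\mathbb{Z})$ is called a totally non congruence group if for every $n\in\mathbb{N}$ (i.e. $n \ge 1$) the image of $\Gamma$ under the canonical projection $\mathrm{SL}(2,\mathbb{Z})\to \mathrm{SL}(2,\mathbb{Z}/n\mathbb{Z})$ is the full group $\mathrm{SL}(2,\mathbb{Z}/n\mathbb{Z})$. *)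

theory Defs
  imports "HOL-Analysis.Analysis" "HOL-Algebra.Coset" "HOL-Number_Theory.Cong"
begin

definition SL2Z :: "(int^2^2) monoid" where
  "SL2Z = \<lparr>carrier = {A. det A = 1}, monoid.mult = (**), one = mat 1\<rparr>"

definition mat_mod :: "nat \<Rightarrow> int^2^2 \<Rightarrow> int^2^2" where
  "mat_mod n A = (\<chi> i j. A $ i $ j mod int n)"

text \<open>The ring \<open>\<int>/n\<int>\<close> is represented by the residues \<open>0, \<dots>, n - 1\<close>, so that
  \<^const>\<open>mat_mod\<close> is the canonical projection from \<^const>\<open>SL2Z\<close>. The definition is meaningful
  for \<open>n \<ge> 1\<close>; for \<open>n = 1\<close> it is the trivial group.\<close>

definition SL2Z_mod :: "nat \<Rightarrow> (int^2^2) monoid" where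
  "SL2Z_mod n = \<lparr>carrier = {A. (\<forall>i j. A $ i $ j \<in> {0..<int n}) \<and> [det A = 1] (mod int n)},
     monoid.mult = (\<lambda>A B. mat_mod n (A ** B)), one = mat_mod n (mat 1)\<rparr>"

definition finite_index_subgroup :: "'a set \<Rightarrow> ('a, 'b) monoid_scheme \<Rightarrow> bool" where
  "finite_index_subgroup H G \<longleftrightarrow> subgroup H G \<and> finite (rcosets\<^bsub>G\<^esub> H)"

definition totally_non_congruence :: "(int^2^2) set \<Rightarrow> bool" where
  "totally_non_congruence \<Gamma> \<longleftrightarrow> finite_index_subgroup \<Gamma> SL2Z \<and>
     (\<forall>n\<ge>1. mat_mod n ` \<Gamma> = carrier (SL2Z_mod n))"

definition e1 :: "int^2" where
  "e1 = vector [1, 0]"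

definition T :: "int^2^2" where
  "T = vector [vector [1, 1], vector [0, 1]]"

definition vec_cong :: "nat \<Rightarrow> int^2 \<Rightarrow> int^2 \<Rightarrow> bool" where
  "vec_cong p v w \<longleftrightarrow> (\<forall>i. [v $ i = w $ i] (mod int p))"

lemma group_SL2Z: "group SL2Z"
proof (rule groupI)
  fix A assume "A \<in> carrier SL2Z"
  then have d: "A$1$1 * A$2$2 - A$1$2 * A$2$1 = 1"
    by (simp add: SL2Z_def det_2)
  define B :: "int^2^2" where "B = vector [vector [A$2$2, - A$1$2], vector [- A$2$1, A$1$1]]"
  have "det B = 1" "B ** A = mat 1"
    using d by (auto simp: B_def det_2 vec_eq_iff forall_2 matrix_matrix_mult_def sum_2 mat_def
        algebra_simps)
  then show "\<exists>B\<in>carrier SL2Z. B \<otimes>\<^bsub>SL2Z\<^esub> A = \<one>\<^bsub>SL2Z\<^esub>"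
    by (auto simp: SL2Z_def)
qed (auto simp: SL2Z_def det_mul matrix_mul_assoc)

lemma cong_det_mat_mod: "[det (mat_mod n A) = det A] (mod int n)"
  by (auto simp: det_2 mat_mod_def intro!: cong_diff cong_mult)

lemma mat_mod_mult: "mat_mod n (mat_mod n A ** mat_mod n B) = mat_mod n (A ** B)"
proof -
  have "[(\<Sum>k\<in>UNIV. (A $ i $ k mod int n) * (B $ k $ j mod int n)) =
      (\<Sum>k\<in>UNIV. A $ i $ k * B $ k $ j)] (mod int n)" for i j
    by (intro cong_sum cong_mult) simp_all
  then show ?thesis
    by (simp add: mat_mod_def vec_eq_iff matrix_matrix_mult_def cong_def)
qed

lemma mat_mod_id: "A \<in> carrier (SL2Z_mod n) \<Longrightarrow> mat_mod n A = A"
  by (simp add: mat_mod_def SL2Z_mod_def vec_eq_iff)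

lemma mat_mod_carrier:
  assumes "n \<ge> 1" and "[det A = 1] (mod int n)"
  shows "mat_mod n A \<in> carrier (SL2Z_mod n)"
  using assms cong_trans[OF cong_det_mat_mod assms(2)]
  by (auto simp: SL2Z_mod_def) (auto simp: mat_mod_def)

lemma SL2Z_mod_mult: "A \<otimes>\<^bsub>SL2Z_mod n\<^esub> B = mat_mod n (A ** B)"
  by (simp add: SL2Z_mod_def)

lemma SL2Z_mod_one: "\<one>\<^bsub>SL2Z_mod n\<^esub> = mat_mod n (mat 1)"
  by (simp add: SL2Z_mod_def)

lemma group_SL2Z_mod:
  assumes "n \<ge> 1"
  shows "group (SL2Z_mod n)"
proof (rule groupI)
  fix A B assume A: "A \<in> carrier (SL2Z_mod n)" and B: "B \<in> carrier (SL2Z_mod n)"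
  have "[det A * det B = 1 * 1] (mod int n)"
    using A B by (intro cong_mult) (auto simp: SL2Z_mod_def)
  then show "A \<otimes>\<^bsub>SL2Z_mod n\<^esub> B \<in> carrier (SL2Z_mod n)"
    using assms by (simp add: SL2Z_mod_mult mat_mod_carrier det_mul)
next
  show "\<one>\<^bsub>SL2Z_mod n\<^esub> \<in> carrier (SL2Z_mod n)"
    using assms by (simp add: SL2Z_mod_one mat_mod_carrier)
next
  fix A B C
  assume A: "A \<in> carrier (SL2Z_mod n)" and C: "C \<in> carrier (SL2Z_mod n)"
  have "mat_mod n (mat_mod n (A ** B) ** C) = mat_mod n (mat_mod n (A ** B) ** mat_mod n C)"
    using C by (simp add: mat_mod_id)
  also have "\<dots> = mat_mod n (mat_mod n A ** mat_mod n (B ** C))"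
    by (simp add: mat_mod_mult matrix_mul_assoc)
  finally show "A \<otimes>\<^bsub>SL2Z_mod n\<^esub> B \<otimes>\<^bsub>SL2Z_mod n\<^esub> C = A \<otimes>\<^bsub>SL2Z_mod n\<^esub> (B \<otimes>\<^bsub>SL2Z_mod n\<^esub> C)"
    using A by (simp add: SL2Z_mod_mult mat_mod_id)
next
  fix A assume A: "A \<in> carrier (SL2Z_mod n)"
  have "mat_mod n (mat_mod n (mat 1) ** mat_mod n A) = mat_mod n A"
    by (simp add: mat_mod_mult)
  then show "\<one>\<^bsub>SL2Z_mod n\<^esub> \<otimes>\<^bsub>SL2Z_mod n\<^esub> A = A"
    using A by (simp add: SL2Z_mod_mult SL2Z_mod_one mat_mod_id)
next
  fix A assume A: "A \<in> carrier (SL2Z_mod n)"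
  define B :: "int^2^2" where "B = vector [vector [A$2$2, - A$1$2], vector [- A$2$1, A$1$1]]"
  have d: "det B = det A"
    by (simp add: B_def det_2 algebra_simps)
  have dA: "det A mod int n = 1 mod int n"
    using A by (simp add: SL2Z_mod_def cong_def)
  have "B ** A = (\<chi> i j. if i = j then det A else 0)"
    by (simp add: B_def det_2 vec_eq_iff forall_2 matrix_matrix_mult_def sum_2 algebra_simps)
  then have "mat_mod n (B ** A) = mat_mod n (mat 1)"
    using dA by (simp add: mat_mod_def mat_def vec_eq_iff)
  then have "mat_mod n (mat_mod n B ** A) = mat_mod n (mat 1)"
    using mat_mod_mult[of n B A] A by (simp add: mat_mod_id)
  moreover have "mat_mod n B \<in> carrier (SL2Z_mod n)"
    using assms d dA by (intro mat_mod_carrier) (auto simp: cong_def)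
  ultimately show "\<exists>B\<in>carrier (SL2Z_mod n). B \<otimes>\<^bsub>SL2Z_mod n\<^esub> A = \<one>\<^bsub>SL2Z_mod n\<^esub>"
    by (auto simp: SL2Z_mod_mult SL2Z_mod_one)
qed

lemma mat_mod_hom:
  assumes "n \<ge> 1"
  shows "mat_mod n \<in> hom SL2Z (SL2Z_mod n)"
  using assms by (auto simp: hom_def SL2Z_def SL2Z_mod_mult mat_mod_mult mat_mod_carrier)

end

theory Submission
  imports Defs
begin

text \<open>
  Let \<open>p\<close> be a prime and \<open>b\<close> coprime to \<open>p\<close>. The \<open>b\<close>-th powers of the two given transvections in
  \<open>\<Gamma>\<close> are trivial modulo \<open>b\<close>, but modulo \<open>p ^ k\<close> they still generate the full transvection
  groups along \<open>A\<^sub>1e\<^sub>1\<close> and \<open>A\<^sub>2e\<^sub>1\<close>. These vectors form a basis modulo \<open>p ^ k\<close> by (A), so in that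
  basis one sees all elementary matrices, which generate the special linear group over the local
  ring \<open>\<int>/p ^ k\<close>. Thus \<open>\<Gamma>\<close> realises every residue class modulo \<open>p ^ k\<close> by elements that are
  trivial modulo \<open>b\<close>, and the prime powers dividing \<open>n\<close> can be treated independently by the Chinese
  remainder theorem.
\<close>

section \<open>Integer 2 x 2 matrices and their reduction modulo n\<close>

definition mat2 :: "int \<Rightarrow> int \<Rightarrow> int \<Rightarrow> int \<Rightarrow> int^2^2" where
  "mat2 a b c d = vector [vector [a, b], vector [c, d]]"

lemma mat2_nth [simp]:
  "mat2 a b c d $ 1 $ 1 = a" "mat2 a b c d $ 1 $ 2 = b"
  "mat2 a b c d $ 2 $ 1 = c" "mat2 a b c d $ 2 $ 2 = d"
  by (simp_all add: mat2_def)

lemma mat2_eta: "mat2 (A $ 1 $ 1) (A $ 1 $ 2) (A $ 2 $ 1) (A $ 2 $ 2) = A"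
  by (simp add: vec_eq_iff forall_2)

lemma mat2_cases: obtains a b c d where "A = mat2 a b c d"
  by (metis mat2_eta)

lemma mat2_mult:
  "mat2 a b c d ** mat2 a' b' c' d' =
    mat2 (a * a' + b * c') (a * b' + b * d') (c * a' + d * c') (c * b' + d * d')"
  by (simp add: vec_eq_iff forall_2 matrix_matrix_mult_def sum_2)

lemma det_mat2 [simp]: "det (mat2 a b c d) = a * d - b * c"
  by (simp add: det_2)

lemma mat_1_eq_mat2: "mat 1 = mat2 1 0 0 1"
  by (simp add: vec_eq_iff forall_2 mat_def)

lemma mat_mod_eq_iff: "mat_mod n A = mat_mod n B \<longleftrightarrow> (\<forall>i j. [A $ i $ j = B $ i $ j] (mod int n))"
  by (simp add: mat_mod_def vec_eq_iff cong_def)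

lemma mat_mod_mat2_eq_iff:
  "mat_mod n (mat2 a b c d) = mat_mod n (mat2 a' b' c' d') \<longleftrightarrow>
    [a = a'] (mod int n) \<and> [b = b'] (mod int n) \<and> [c = c'] (mod int n) \<and> [d = d'] (mod int n)"
  by (auto simp: mat_mod_eq_iff forall_2)

lemma mat_mod_mult_cong:
  assumes "mat_mod n A = mat_mod n A'" "mat_mod n B = mat_mod n B'"
  shows "mat_mod n (A ** B) = mat_mod n (A' ** B')"
  by (metis assms mat_mod_mult)

lemma mat_mod_dvd_cong:
  assumes "mat_mod n A = mat_mod n B" "m dvd n"
  shows "mat_mod m A = mat_mod m B"
  using assms by (auto simp: mat_mod_eq_iff intro: cong_dvd_modulus[of _ _ "int n"])

lemma mat_mod_coprime_mult_cong:
  assumes "mat_mod m A = mat_mod m B" "mat_mod n A = mat_mod n B" "coprime m n"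
  shows "mat_mod (m * n) A = mat_mod (m * n) B"
  using assms by (auto simp: mat_mod_eq_iff intro!: coprime_cong_mult)

section \<open>Generation of SL(2) over the local ring Z/p^k\<close>

text \<open>Some entry of the first column is a unit, since the determinant is. If it is the lower
  one, the matrix is a product of three elementary ones; otherwise a row operation reduces to that
  case. Working with a set of integer matrices saturated under congruence avoids passing to the
  quotient.\<close>

lemma elementary_matrices_generate_local:
  fixes S :: "(int^2^2) set"
  assumes p: "prime p" and k: "k > 0"
    and cong: "\<And>X Y. X \<in> S \<Longrightarrow> mat_mod (p ^ k) X = mat_mod (p ^ k) Y \<Longrightarrow> Y \<in> S"
    and mult: "\<And>X Y. X \<in> S \<Longrightarrow> Y \<in> S \<Longrightarrow> X ** Y \<in> S"
    and upper: "\<And>t. mat2 1 t 0 1 \<in> S" and lower: "\<And>t. mat2 1 0 t 1 \<in> S"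
    and det: "[det X = 1] (mod int (p ^ k))"
  shows "X \<in> S"
proof -
  let ?N = "int (p ^ k)"
  have unit: "mat2 a b c d \<in> S" if dt: "[a * d - b * c = 1] (mod ?N)" and c: "\<not> int p dvd c"
    for a b c d
  proof -
    have "coprime c ?N"
      using p c prime_imp_coprime[of "int p" c] by (simp add: coprime_commute)
    then obtain u where u: "[c * u = 1] (mod ?N)"
      using cong_solve_coprime_int by blast
    \<comment> \<open>If \<open>c\<close> is invertible, the matrix factors as \<open>E\<^sub>1\<^sub>2(s) E\<^sub>2\<^sub>1(c) E\<^sub>1\<^sub>2(r)\<close>.\<close>
    define s r where "s = (a - 1) * u" and "r = (d - 1) * u"
    have "mat2 1 s 0 1 ** mat2 1 0 c 1 ** mat2 1 r 0 1 \<in> S"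
      using mult upper lower by blast
    then have S: "mat2 (1 + s * c) ((1 + s * c) * r + s) c (c * r + 1) \<in> S"
      by (simp add: mat2_mult)
    have cu: "[x * (c * u) = x] (mod ?N)" for x
      using cong_scalar_left[OF u, of x] by simp
    have a: "[1 + s * c = a] (mod ?N)"
      using cong_add[OF cong_refl[of 1] cu[of "a - 1"]] by (simp add: s_def algebra_simps)
    have d: "[c * r + 1 = d] (mod ?N)"
      using cong_add[OF cong_refl[of 1] cu[of "d - 1"]] by (simp add: r_def algebra_simps)
    have "[(1 + s * c) * r + s = a * r + s] (mod ?N)"
      using a by (intro cong_add cong_mult) auto
    also have "a * r + s = (a * d - 1) * u"
      by (simp add: r_def s_def algebra_simps)
    also have "[(a * d - 1) * u = (b * c) * u] (mod ?N)"
      using dt by (intro cong_mult) (auto simp: cong_iff_dvd_diff algebra_simps)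
    also have "b * c * u = b * (c * u)"
      by (simp add: mult.assoc)
    also have "[b * (c * u) = b] (mod ?N)"
      by (rule cu)
    finally show ?thesis
      using a d by (intro cong[OF S]) (simp add: mat_mod_mat2_eq_iff)
  qed
  obtain a b c d where X: "X = mat2 a b c d"
    by (rule mat2_cases)
  have dt: "[a * d - b * c = 1] (mod ?N)"
    using det by (simp add: X)
  show ?thesis
  proof (cases "int p dvd c")
    case False
    then show ?thesis
      using unit dt by (simp add: X)
  next
    case True
    have "int p dvd ?N"
      using k by simp
    then have "int p dvd a * d - b * c - 1"
      using dt by (meson cong_iff_dvd_diff dvd_trans)
    moreover have "\<not> int p dvd 1"
      using prime_gt_1_nat[OF p] by simp
    ultimately have "\<not> int p dvd a"
      using True by (metis dvd_diffD dvd_diff dvd_mult dvd_mult2 diff_diff_eq2 dvd_diff_right_iff)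
    then have "\<not> int p dvd a + c"
      using True by (simp add: dvd_add_left_iff)
    moreover have "[a * (b + d) - b * (a + c) = 1] (mod ?N)"
      using dt by (simp add: algebra_simps)
    \<comment> \<open>The first row has been added to the second; left multiplication by
      \<open>mat2 1 0 (- 1) 1\<close> undoes this.\<close>
    ultimately have "mat2 a b (a + c) (b + d) \<in> S"
      by (intro unit)
    with lower mult have "mat2 1 0 (- 1) 1 ** mat2 a b (a + c) (b + d) \<in> S"
      by blast
    then show ?thesis
      by (simp add: X mat2_mult)
  qed
qed

text \<open>With v = (x, y), this is the map sending w to w + t det(v, w) v.\<close>

definition transvection :: "int \<Rightarrow> int \<Rightarrow> int \<Rightarrow> int^2^2" where
  "transvection x y t = mat2 (1 - t * x * y) (t * x * x) (- (t * y * y)) (1 + t * x * y)"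

lemma transvection_0: "transvection x y 0 = mat 1"
  by (simp add: transvection_def mat_1_eq_mat2)

lemma transvection_mult:
  "transvection x y s ** transvection x y t = transvection x y (s + t)"
  by (simp add: transvection_def mat2_mult algebra_simps)

lemma transvection_cong:
  assumes "[s = t] (mod int n)"
  shows "mat_mod n (transvection x y s) = mat_mod n (transvection x y t)"
  using assms unfolding transvection_def mat_mod_mat2_eq_iff
  by (intro conjI cong_add cong_diff cong_mult cong_refl cong_minus_minus_iff[THEN iffD2])

text \<open>The two directions form a basis modulo p^k. After rescaling one of them to make the base
  change unimodular, conjugation turns the transvections into upper and lower elementary
  matrices.\<close>

lemma transvections_generate_local:
  fixes S :: "(int^2^2) set"
  assumes p: "prime p" and k: "k > 0"
    and cong: "\<And>X Y. X \<in> S \<Longrightarrow> mat_mod (p ^ k) X = mat_mod (p ^ k) Y \<Longrightarrow> Y \<in> S"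
    and mult: "\<And>X Y. X \<in> S \<Longrightarrow> Y \<in> S \<Longrightarrow> X ** Y \<in> S"
    and tv1: "\<And>t. transvection x\<^sub>1 y\<^sub>1 t \<in> S" and tv2: "\<And>t. transvection x\<^sub>2 y\<^sub>2 t \<in> S"
    and indep: "\<not> int p dvd x\<^sub>1 * y\<^sub>2 - x\<^sub>2 * y\<^sub>1"
    and det: "[det X = 1] (mod int (p ^ k))"
  shows "X \<in> S"
proof -
  let ?N = "int (p ^ k)"
  define \<delta> where "\<delta> = x\<^sub>1 * y\<^sub>2 - x\<^sub>2 * y\<^sub>1"
  have "coprime \<delta> ?N"
    using p indep prime_imp_coprime[of "int p" \<delta>] by (simp add: coprime_commute \<delta>_def)
  then obtain e where e: "[\<delta> * e = 1] (mod ?N)"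
    using cong_solve_coprime_int by blast
  \<comment> \<open>The columns of \<open>Q\<close> are the two directions, the second scaled by
    \<open>e\<close> so that the determinant \<open>\<delta> * e\<close> is 1 modulo p^k.
    \<open>R\<close> is the adjugate of \<open>Q\<close>, hence its inverse modulo p^k.\<close>
  define Q R where "Q = mat2 x\<^sub>1 (e * x\<^sub>2) y\<^sub>1 (e * y\<^sub>2)"
    and "R = mat2 (e * y\<^sub>2) (- (e * x\<^sub>2)) (- y\<^sub>1) x\<^sub>1"
  have dQ: "[det Q = 1] (mod ?N)" and dR: "[det R = 1] (mod ?N)"
    using e by (simp_all add: Q_def R_def \<delta>_def algebra_simps)
  have QR: "mat_mod (p ^ k) (Q ** R) = mat_mod (p ^ k) (mat 1)"
    and RQ: "mat_mod (p ^ k) (R ** Q) = mat_mod (p ^ k) (mat 1)"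
    using e unfolding Q_def R_def mat_1_eq_mat2 mat2_mult mat_mod_mat2_eq_iff
    by (simp_all add: \<delta>_def algebra_simps)
  define S' where "S' = {Y. Q ** Y ** R \<in> S}"
  have "R ** X ** Q \<in> S'"
  proof (rule elementary_matrices_generate_local[OF p k])
    fix Y Z assume Y: "Y \<in> S'"
    show "Z \<in> S'" if "mat_mod (p ^ k) Y = mat_mod (p ^ k) Z"
      using Y that unfolding S'_def by (blast intro: cong mat_mod_mult_cong)
    show "Y ** Z \<in> S'" if "Z \<in> S'"
    proof -
      have "Q ** Y ** R ** (Q ** Z ** R) \<in> S"
        using Y that mult unfolding S'_def by blast
      \<comment> \<open>The inner factor \<open>R ** Q\<close> is the identity only modulo p^k, so
        the product is corrected by saturation of \<open>S\<close>.\<close>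
      moreover have "mat_mod (p ^ k) (Q ** Y ** (R ** Q) ** (Z ** R)) =
          mat_mod (p ^ k) (Q ** Y ** mat 1 ** (Z ** R))"
        by (intro mat_mod_mult_cong RQ refl)
      ultimately show ?thesis
        unfolding S'_def by (auto simp: matrix_mul_assoc intro: cong)
    qed
  next
    fix t
    have c: "[\<delta> * e + r = 1 + r] (mod ?N)" for r
      using e by (intro cong_add) auto
    have "mat_mod (p ^ k) (transvection x\<^sub>1 y\<^sub>1 t) = mat_mod (p ^ k) (Q ** mat2 1 t 0 1 ** R)"
      using c[of "- (t * x\<^sub>1 * y\<^sub>1)"] c[of "t * x\<^sub>1 * y\<^sub>1"]
      unfolding Q_def R_def transvection_def mat2_mult mat_mod_mat2_eq_iff
      by (auto simp: \<delta>_def algebra_simps cong_sym_eq)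
    then show "mat2 1 t 0 1 \<in> S'"
      unfolding S'_def using cong tv1 by blast
    \<comment> \<open>The lower elementary matrix with entry t is the transvection along the second
      basis vector with parameter -t; that direction is scaled by \<open>e\<close>, which enters
      quadratically.\<close>
    define s where "s = - (t * e * e)"
    have "mat_mod (p ^ k) (transvection x\<^sub>2 y\<^sub>2 s) = mat_mod (p ^ k) (Q ** mat2 1 0 t 1 ** R)"
      using c[of "- (s * x\<^sub>2 * y\<^sub>2)"] c[of "s * x\<^sub>2 * y\<^sub>2"]
      unfolding Q_def R_def transvection_def mat2_mult mat_mod_mat2_eq_iff
      by (auto simp: \<delta>_def s_def algebra_simps cong_sym_eq)
    then show "mat2 1 0 t 1 \<in> S'"
      unfolding S'_def using cong tv2 by blast
  next
    have "[det R * det X * det Q = 1 * 1 * 1] (mod ?N)"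
      by (intro cong_mult dQ dR det)
    then show "[det (R ** X ** Q) = 1] (mod ?N)"
      by (simp add: det_mul)
  qed
  then have "Q ** R ** X ** (Q ** R) \<in> S"
    by (simp add: S'_def matrix_mul_assoc)
  moreover have "mat_mod (p ^ k) (Q ** R ** X ** (Q ** R)) = mat_mod (p ^ k) (mat 1 ** X ** mat 1)"
    by (intro mat_mod_mult_cong QR refl)
  ultimately show ?thesis
    using cong by auto
qed

section \<open>Hypotheses (A) and (B) in terms of transvections\<close>

lemma SL2Z_simps:
  "carrier SL2Z = {A. det A = 1}" "A \<otimes>\<^bsub>SL2Z\<^esub> B = A ** B" "\<one>\<^bsub>SL2Z\<^esub> = mat 1"
  by (simp_all add: SL2Z_def)

lemma inv_SL2Z_mat2:
  assumes "a * d - b * c = 1"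
  shows "inv\<^bsub>SL2Z\<^esub> (mat2 a b c d) = mat2 d (- b) (- c) a"
proof (rule group.inv_equality[OF group_SL2Z])
  show "mat2 d (- b) (- c) a \<otimes>\<^bsub>SL2Z\<^esub> mat2 a b c d = \<one>\<^bsub>SL2Z\<^esub>"
    using assms by (simp add: SL2Z_simps mat2_mult mat_1_eq_mat2 algebra_simps)
qed (use assms in \<open>simp_all add: SL2Z_simps algebra_simps\<close>)

lemma T_pow_SL2Z: "T [^]\<^bsub>SL2Z\<^esub> (m::nat) = mat2 1 (int m) 0 1"
proof (induction m)
  case 0
  then show ?case
    by (simp add: SL2Z_simps mat_1_eq_mat2 nat_pow_def)
next
  case (Suc m)
  have T: "T = mat2 1 1 0 1"
    by (simp add: T_def mat2_def)
  show ?case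
    using Suc unfolding nat_pow_def by (simp add: SL2Z_simps mat2_mult T)
qed

text \<open>The power of \<open>T\<close> is the transvection along \<open>e1\<close> with parameter
  m, and conjugation by a matrix of determinant 1 moves the direction to the first column of that
  matrix.\<close>

lemma conj_T_pow_eq_transvection:
  assumes "A \<in> carrier SL2Z"
  shows "A \<otimes>\<^bsub>SL2Z\<^esub> (T [^]\<^bsub>SL2Z\<^esub> (m::nat)) \<otimes>\<^bsub>SL2Z\<^esub> inv\<^bsub>SL2Z\<^esub> A = transvection (A $ 1 $ 1) (A $ 2 $ 1) (int m)"
proof -
  obtain a b c d where A: "A = mat2 a b c d"
    by (rule mat2_cases)
  have dt: "a * d - b * c = 1"
    using assms by (simp add: A SL2Z_simps)
  then have "a * d = 1 + b * c"
    by simp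
  then show ?thesis
    using dt unfolding A inv_SL2Z_mat2[OF dt] T_pow_SL2Z
    by (simp add: SL2Z_simps mat2_mult transvection_def algebra_simps)
qed

lemma subgroup_SL2Z_transvection_mult:
  assumes "subgroup \<Gamma> SL2Z" "transvection x y m \<in> \<Gamma>"
  shows "transvection x y (m * int j) \<in> \<Gamma>"
proof (induction j)
  case 0
  then show ?case
    using subgroup.one_closed[OF assms(1)] by (simp add: transvection_0 SL2Z_simps)
next
  case (Suc j)
  then show ?case
    using subgroup.m_closed[OF assms(1) Suc assms(2)]
    by (simp add: SL2Z_simps transvection_mult algebra_simps)
qed

text \<open>If the determinant of the two columns vanished modulo p, then the first column of
  \<open>A\<^sub>1\<close> would be a multiple of that of \<open>A\<^sub>2\<close>, because the
  latter extends to a unimodular basis.\<close>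

lemma first_columns_independent:
  assumes A2: "A\<^sub>2 \<in> carrier SL2Z" and p: "prime p"
    and ncong: "\<And>j::nat. j \<ge> 1 \<Longrightarrow> \<not> vec_cong p (A\<^sub>1 *v e1) (int j *s (A\<^sub>2 *v e1))"
  shows "\<not> int p dvd A\<^sub>1 $ 1 $ 1 * A\<^sub>2 $ 2 $ 1 - A\<^sub>2 $ 1 $ 1 * A\<^sub>1 $ 2 $ 1"
proof
  obtain a b c d where A1: "A\<^sub>1 = mat2 a b c d"
    by (rule mat2_cases)
  obtain x u y v where A2': "A\<^sub>2 = mat2 x u y v"
    by (rule mat2_cases)
  have dt: "x * v - u * y = 1"
    using A2 by (simp add: A2' SL2Z_simps)
  assume "int p dvd A\<^sub>1 $ 1 $ 1 * A\<^sub>2 $ 2 $ 1 - A\<^sub>2 $ 1 $ 1 * A\<^sub>1 $ 2 $ 1"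
  then have dvd: "int p dvd a * y - x * c"
    by (simp add: A1 A2')
  \<comment> \<open>The first coordinate of \<open>A\<^sub>1 *v e1\<close> in the basis of columns
    of \<open>A\<^sub>2\<close>; the second coordinate is, up to sign, the determinant divisible by
    p.\<close>
  define i where "i = v * a - u * c"
  \<comment> \<open>Adding \<open>p\<close> keeps the residue and ensures \<open>j \<ge> 1\<close>
    even if the residue is 0.\<close>
  define j where "j = nat (i mod int p) + p"
  have p0: "p > 0"
    using p by (rule prime_gt_0_nat)
  then have j: "[int j = i] (mod int p)" and j1: "j \<ge> 1"
    by (simp_all add: j_def cong_def)
  have "a - i * x = a * (x * v - u * y) - i * x" "c - i * y = c * (x * v - u * y) - i * y"
    using dt by simp_all
  then have "a - i * x = - u * (a * y - x * c)" "c - i * y = - v * (a * y - x * c)"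
    by (simp_all add: i_def algebra_simps)
  then have "[a = i * x] (mod int p)" "[c = i * y] (mod int p)"
    using dvd by (simp_all add: cong_iff_dvd_diff)
  moreover have "[i * x = int j * x] (mod int p)" "[i * y = int j * y] (mod int p)"
    using j by (auto intro!: cong_mult simp: cong_sym_eq)
  ultimately have "[a = int j * x] (mod int p)" "[c = int j * y] (mod int p)"
    by (blast intro: cong_trans)+
  then have "vec_cong p (A\<^sub>1 *v e1) (int j *s (A\<^sub>2 *v e1))"
    by (simp add: vec_cong_def forall_2 matrix_vector_mult_def sum_2 e1_def A1 A2')
  with ncong j1 show False
    by blast
qed

section \<open>Prescribing residues independently at coprime moduli\<close>

text \<open>\<open>realizes \<Gamma> a\<close> lets \<open>\<Gamma>\<close> hit every residue class modulo \<open>a\<close> independently of any prescribed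
  coprime modulus \<open>b\<close>; this independence is what makes the property multiplicative in \<open>a\<close>.\<close>

definition realizes :: "(int^2^2) set \<Rightarrow> nat \<Rightarrow> bool" where
  "realizes \<Gamma> a \<longleftrightarrow> (\<forall>b>0. coprime a b \<longrightarrow> (\<forall>A. [det A = 1] (mod int a) \<longrightarrow>
     (\<exists>\<gamma>\<in>\<Gamma>. mat_mod a \<gamma> = mat_mod a A \<and> mat_mod b \<gamma> = mat_mod b (mat 1))))"

lemma realizesE:
  assumes "realizes \<Gamma> a" "b > 0" "coprime a b" "[det A = 1] (mod int a)"
  obtains \<gamma> where "\<gamma> \<in> \<Gamma>" "mat_mod a \<gamma> = mat_mod a A" "mat_mod b \<gamma> = mat_mod b (mat 1)"
  using assms unfolding realizes_def by metis

lemma realizes_1: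
  assumes "subgroup \<Gamma> SL2Z"
  shows "realizes \<Gamma> 1"
  using subgroup.one_closed[OF assms]
  by (auto simp: realizes_def SL2Z_simps mat_mod_eq_iff intro!: bexI[of _ "mat 1"])

text \<open>Take g equal to A modulo a and trivial modulo a'b, and h equal to A modulo a' and
  trivial modulo ab; then gh has the required residues at a, a' and b.\<close>

lemma realizes_mult:
  assumes \<Gamma>: "subgroup \<Gamma> SL2Z" and a: "realizes \<Gamma> a" and a': "realizes \<Gamma> a'"
    and cop: "coprime a a'" and pos: "a > 0" "a' > 0"
  shows "realizes \<Gamma> (a * a')"
  unfolding realizes_def
proof (intro allI impI)
  fix b :: nat and A :: "int^2^2"
  assume b: "b > 0" "coprime (a * a') b" and A: "[det A = 1] (mod int (a * a'))"
  have A': "[det A = 1] (mod int a)" "[det A = 1] (mod int a')"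
    using A by (auto intro: cong_modulus_mult simp: mult.commute)
  have cop': "coprime a (a' * b)" "coprime a' (a * b)"
    using b cop by (auto simp: coprime_commute)
  have pos': "a' * b > 0" "a * b > 0"
    using b pos by auto
  obtain g where g: "g \<in> \<Gamma>" "mat_mod a g = mat_mod a A"
    "mat_mod (a' * b) g = mat_mod (a' * b) (mat 1)"
    by (rule realizesE[OF a pos'(1) cop'(1) A'(1)])
  obtain h where h: "h \<in> \<Gamma>" "mat_mod a' h = mat_mod a' A"
    "mat_mod (a * b) h = mat_mod (a * b) (mat 1)"
    by (rule realizesE[OF a' pos'(2) cop'(2) A'(2)])
  have g': "mat_mod a' g = mat_mod a' (mat 1)" "mat_mod b g = mat_mod b (mat 1)"
    using mat_mod_dvd_cong[OF g(3)] by simp_all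
  have h': "mat_mod a h = mat_mod a (mat 1)" "mat_mod b h = mat_mod b (mat 1)"
    using mat_mod_dvd_cong[OF h(3)] by simp_all
  have "mat_mod a (g ** h) = mat_mod a A" "mat_mod a' (g ** h) = mat_mod a' A"
    "mat_mod b (g ** h) = mat_mod b (mat 1)"
    using mat_mod_mult_cong[OF g(2) h'(1)] mat_mod_mult_cong[OF g'(1) h(2)]
      mat_mod_mult_cong[OF g'(2) h'(2)] by simp_all
  moreover from this have "mat_mod (a * a') (g ** h) = mat_mod (a * a') A"
    using cop by (intro mat_mod_coprime_mult_cong)
  moreover have "g ** h \<in> \<Gamma>"
    using subgroup.m_closed[OF \<Gamma> g(1) h(1)] by (simp add: SL2Z_simps)
  ultimately show "\<exists>\<gamma>\<in>\<Gamma>. mat_mod (a * a') \<gamma> = mat_mod (a * a') A \<and> mat_mod b \<gamma> = mat_mod b (mat 1)"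
    by blast
qed

lemma realizes_prime_power:
  assumes \<Gamma>: "subgroup \<Gamma> SL2Z" and p: "prime p" and k: "k > 0"
    and tv: "transvection x\<^sub>1 y\<^sub>1 (int m\<^sub>1) \<in> \<Gamma>" "transvection x\<^sub>2 y\<^sub>2 (int m\<^sub>2) \<in> \<Gamma>"
    and m: "\<not> p dvd m\<^sub>1" "\<not> p dvd m\<^sub>2"
    and indep: "\<not> int p dvd x\<^sub>1 * y\<^sub>2 - x\<^sub>2 * y\<^sub>1"
  shows "realizes \<Gamma> (p ^ k)"
  unfolding realizes_def
proof (intro allI impI)
  fix b :: nat and A :: "int^2^2"
  assume b: "b > 0" "coprime (p ^ k) b" and A: "[det A = 1] (mod int (p ^ k))"
  define S where
    "S = {X. \<exists>\<gamma>\<in>\<Gamma>. mat_mod (p ^ k) \<gamma> = mat_mod (p ^ k) X \<and> mat_mod b \<gamma> = mat_mod b (mat 1)}"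
  have S_transvection: "transvection x y t \<in> S"
    if tvm: "transvection x y (int m) \<in> \<Gamma>" and m: "\<not> p dvd m" for x y t m
  proof -
    have "coprime (m * b) (p ^ k)"
      using b m k prime_imp_coprime[OF p m] by (simp add: coprime_commute)
    then have "coprime (int (m * b)) (int (p ^ k))"
      using coprime_int_iff by blast
    then obtain u where u: "[int (m * b) * u = 1] (mod int (p ^ k))"
      using cong_solve_coprime_int by blast
    \<comment> \<open>The power with exponent \<open>b * j\<close> has parameter
      \<open>m * b * j\<close>, which is t modulo p^k and 0 modulo b. Reducing first makes
      \<open>j\<close> a natural number.\<close>
    define j where "j = nat (u * t mod int (p ^ k))"
    have "p ^ k > 0"
      using prime_gt_0_nat[OF p] by simp
    then have "[int j = u * t] (mod int (p ^ k))"
      by (simp add: j_def cong_def)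
    then have "[int (m * b) * int j = int (m * b) * (u * t)] (mod int (p ^ k))"
      by (rule cong_scalar_left)
    moreover have "[int (m * b) * u * t = 1 * t] (mod int (p ^ k))"
      using u by (rule cong_scalar_right)
    ultimately have "[int m * int (b * j) = t] (mod int (p ^ k))"
      by (auto simp: mult_ac intro: cong_trans)
    then have "mat_mod (p ^ k) (transvection x y (int m * int (b * j))) =
        mat_mod (p ^ k) (transvection x y t)"
      by (rule transvection_cong)
    moreover have "[int m * int (b * j) = 0] (mod int b)"
      by (simp add: cong_0_iff)
    then have "mat_mod b (transvection x y (int m * int (b * j))) = mat_mod b (mat 1)"
      unfolding transvection_0[of x y, symmetric] by (rule transvection_cong)
    moreover have "transvection x y (int m * int (b * j)) \<in> \<Gamma>"
      by (rule subgroup_SL2Z_transvection_mult[OF \<Gamma> tvm])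
    ultimately show ?thesis
      unfolding S_def by blast
  qed
  have "A \<in> S"
  proof (rule transvections_generate_local[OF p k _ _ _ _ indep A])
    fix X Y assume X: "X \<in> S"
    show "Y \<in> S" if "mat_mod (p ^ k) X = mat_mod (p ^ k) Y"
      using X that by (simp add: S_def)
    assume Y: "Y \<in> S"
    obtain g h where gh: "g \<in> \<Gamma>" "mat_mod (p ^ k) g = mat_mod (p ^ k) X" "mat_mod b g = mat_mod b (mat 1)"
      "h \<in> \<Gamma>" "mat_mod (p ^ k) h = mat_mod (p ^ k) Y" "mat_mod b h = mat_mod b (mat 1)"
      using X Y unfolding S_def by blast
    have "g ** h \<in> \<Gamma>"
      using subgroup.m_closed[OF \<Gamma> gh(1,4)] by (simp add: SL2Z_simps)
    then show "X ** Y \<in> S"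
      using mat_mod_mult_cong[OF gh(2,5)] mat_mod_mult_cong[OF gh(3,6)] by (auto simp: S_def)
  qed (use S_transvection tv m in auto)
  then show "\<exists>\<gamma>\<in>\<Gamma>. mat_mod (p ^ k) \<gamma> = mat_mod (p ^ k) A \<and> mat_mod b \<gamma> = mat_mod b (mat 1)"
    by (simp add: S_def)
qed

text \<open>Splitting off the full power of a prime divisor leaves a smaller coprime cofactor, to
  which induction applies.\<close>

lemma realizes_of_prime_powers:
  assumes \<Gamma>: "subgroup \<Gamma> SL2Z" and pp: "\<And>p k. prime p \<Longrightarrow> k > 0 \<Longrightarrow> realizes \<Gamma> (p ^ k)"
    and n: "n \<ge> 1"
  shows "realizes \<Gamma> n"
  using n
proof (induction n rule: less_induct)
  case (less n)
  show ?case
  proof (cases "n = 1")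
    case True
    then show ?thesis
      using realizes_1[OF \<Gamma>] by simp
  next
    case False
    then obtain p where p: "prime p" "p dvd n"
      using prime_factor_nat by blast
    obtain q where q: "n = p ^ multiplicity p n * q" "\<not> p dvd q"
      using multiplicity_decompose'[of n p] less.prems prime_gt_1_nat[OF p(1)] by auto
    define k where "k = multiplicity p n"
    have k: "k > 0"
      using p less.prems q by (metis k_def gr0I mult_1 power_0)
    have q0: "q > 0"
      using q less.prems by (cases "q = 0") auto
    have pk: "p ^ k > 1"
      using k prime_gt_1_nat[OF p(1)] by (rule one_less_power[rotated])
    have n: "n = p ^ k * q"
      using q k_def by simp
    then have "q < n"
      using q0 pk by simp
    then have "realizes \<Gamma> q"
      using less.IH q0 by simp
    moreover have "coprime (p ^ k) q"
      using q p by (simp add: prime_imp_coprime)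
    ultimately show ?thesis
      unfolding n using realizes_mult[OF \<Gamma> pp[OF p(1) k]] q0 pk by (meson less_trans zero_less_one)
  qed
qed

section \<open>Surjectivity modulo every n\<close>

theorem theorem1:
  fixes \<Gamma> :: "(int^2^2) set"
  assumes "finite_index_subgroup \<Gamma> SL2Z"
    and "\<And>p::nat. prime p \<Longrightarrow>
      \<exists>A\<^sub>1 \<in> carrier SL2Z. \<exists>A\<^sub>2 \<in> carrier SL2Z.
        (\<forall>j::nat. j \<ge> 1 \<longrightarrow> \<not> vec_cong p (A\<^sub>1 *v e1) (int j *s (A\<^sub>2 *v e1))) \<and>
        (\<exists>m\<^sub>1 m\<^sub>2 :: nat. m\<^sub>1 \<ge> 1 \<and> m\<^sub>2 \<ge> 1 \<and>
          A\<^sub>1 \<otimes>\<^bsub>SL2Z\<^esub> (T [^]\<^bsub>SL2Z\<^esub> m\<^sub>1) \<otimes>\<^bsub>SL2Z\<^esub> inv\<^bsub>SL2Z\<^esub> A\<^sub>1 \<in> \<Gamma> \<and>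
          A\<^sub>2 \<otimes>\<^bsub>SL2Z\<^esub> (T [^]\<^bsub>SL2Z\<^esub> m\<^sub>2) \<otimes>\<^bsub>SL2Z\<^esub> inv\<^bsub>SL2Z\<^esub> A\<^sub>2 \<in> \<Gamma> \<and>
          \<not> p dvd m\<^sub>1 \<and> \<not> p dvd m\<^sub>2)"
  shows "totally_non_congruence \<Gamma>"
proof -
  have \<Gamma>: "subgroup \<Gamma> SL2Z"
    using assms(1) by (simp add: finite_index_subgroup_def)
  have pp: "realizes \<Gamma> (p ^ k)" if p: "prime p" and k: "k > 0" for p k :: nat
  proof -
    obtain A\<^sub>1 A\<^sub>2 m\<^sub>1 m\<^sub>2 where A: "A\<^sub>1 \<in> carrier SL2Z" "A\<^sub>2 \<in> carrier SL2Z"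
      "\<And>j::nat. j \<ge> 1 \<Longrightarrow> \<not> vec_cong p (A\<^sub>1 *v e1) (int j *s (A\<^sub>2 *v e1))"
      and mem: "A\<^sub>1 \<otimes>\<^bsub>SL2Z\<^esub> (T [^]\<^bsub>SL2Z\<^esub> (m\<^sub>1::nat)) \<otimes>\<^bsub>SL2Z\<^esub> inv\<^bsub>SL2Z\<^esub> A\<^sub>1 \<in> \<Gamma>"
      "A\<^sub>2 \<otimes>\<^bsub>SL2Z\<^esub> (T [^]\<^bsub>SL2Z\<^esub> (m\<^sub>2::nat)) \<otimes>\<^bsub>SL2Z\<^esub> inv\<^bsub>SL2Z\<^esub> A\<^sub>2 \<in> \<Gamma>"
      and m: "\<not> p dvd m\<^sub>1" "\<not> p dvd m\<^sub>2"
      using assms(2)[OF p] by blast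
    show ?thesis
      using realizes_prime_power[OF \<Gamma> p k _ _ m first_columns_independent[OF A(2) p A(3)]]
        mem A(1,2) by (simp add: conj_T_pow_eq_transvection)
  qed
  have "mat_mod n ` \<Gamma> = carrier (SL2Z_mod n)" if n: "n \<ge> 1" for n
  proof
    show "mat_mod n ` \<Gamma> \<subseteq> carrier (SL2Z_mod n)"
      using mat_mod_hom[OF n] subgroup.subset[OF \<Gamma>] by (auto simp: hom_def)
    show "carrier (SL2Z_mod n) \<subseteq> mat_mod n ` \<Gamma>"
    proof
      fix A assume A: "A \<in> carrier (SL2Z_mod n)"
      then have "[det A = 1] (mod int n)"
        by (simp add: SL2Z_mod_def)
      moreover have "realizes \<Gamma> n"
        using realizes_of_prime_powers[OF \<Gamma> pp n] by blast
      \<comment> \<open>The auxiliary modulus is taken to be 1, where the triviality condition is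
        vacuous.\<close>
      ultimately obtain \<gamma> where "\<gamma> \<in> \<Gamma>" "mat_mod n \<gamma> = mat_mod n A"
        using realizesE[of \<Gamma> n 1 A] by auto
      then show "A \<in> mat_mod n ` \<Gamma>"
        using mat_mod_id[OF A] by (metis image_eqI)
    qed
  qed
  with assms(1) show ?thesis
    by (simp add: totally_non_congruence_def)
qed

end
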